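(* For any positive integers $k,n$, if $A\subseteq V(P_k^{\boxtimes n})$ is non-empty and has size $|A|=\alpha k^n$, then $$\bigl|N_{P_k^{\boxtimes n}}[A]\bigr|\ \ge\ k^n\cdot\min_{t\in\{1,\dots,n\}}\Bigl\{1,\ \bigl(\alpha^{1/t}+1/k\bigr)^t,\ 1-\bigl(\max\{0,(1-\alpha)^{1/t}-1/k\}\bigr)^t\Bigr\}.$$
   Context: $P_k$ denotes the path graph on $k$ vertices. For graphs $G_1,\dots,G_n$, the strong product $G_1\boxtimes\dots\boxtimes G_n$ has vertex set $V(G_1)\times\dots\times V(G_n)$, and distinct vertices $(v_1,\dots,v_n)$ and $(u_1,\dots,u_n)$ are adjacent whenever, for each $i$, either $v_i=u_i$ or $v_iu_i$ is an edge of $G_i$. $G^{\boxtimes n}$ is the $n$-fold strong product of $G$ with itself. $N_G[A]$ is the closed neighborhood of $A\subseteq V(G)$: all vertices in $A$ or adjacent to some vertex in $A$. *)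

theory Defs
  imports
    Complex_Main
    "HOL-Library.FuncSet"
    "Graph_Theory.Pair_Digraph"
begin

text \<open>
  Simple graphs are symmetric loop-free digraphs whose arcs are ordered pairs of vertices
  (locale \<^locale>\<open>pair_graph\<close>); an edge \<open>uv\<close> is represented by the two arcs \<open>(u, v)\<close> and \<open>(v, u)\<close>.
\<close>

definition path_graph :: "nat \<Rightarrow> nat pair_pre_digraph" where
  "path_graph k =
    \<lparr> pverts = {1..k},
      parcs = {(i, j). i \<in> {1..k} \<and> j \<in> {1..k} \<and> (j = Suc i \<or> i = Suc j)} \<rparr>"

text \<open>
  A tuple \<open>(v\<^sub>i)\<close> indexed by \<open>I\<close> is an extensional function on \<open>I\<close>, so that distinct vertices
  differ at some index in \<open>I\<close> and vertices can be counted.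
\<close>

definition strong_product ::
    "'i set \<Rightarrow> ('i \<Rightarrow> 'a pair_pre_digraph) \<Rightarrow> ('i \<Rightarrow> 'a) pair_pre_digraph" where
  "strong_product I G =
    \<lparr> pverts = (\<Pi>\<^sub>E i\<in>I. pverts (G i)),
      parcs = {(v, u). v \<in> (\<Pi>\<^sub>E i\<in>I. pverts (G i)) \<and> u \<in> (\<Pi>\<^sub>E i\<in>I. pverts (G i)) \<and>
                 v \<noteq> u \<and> (\<forall>i\<in>I. v i = u i \<or> (v i, u i) \<in> parcs (G i))} \<rparr>"

definition strong_power :: "'a pair_pre_digraph \<Rightarrow> nat \<Rightarrow> (nat \<Rightarrow> 'a) pair_pre_digraph" where
  "strong_power G n = strong_product {1..n} (\<lambda>_. G)"

definition closed_neighborhood :: "'a pair_pre_digraph \<Rightarrow> 'a set \<Rightarrow> 'a set" where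
  "closed_neighborhood G A = {v \<in> pverts G. v \<in> A \<or> (\<exists>u\<in>A. (u, v) \<in> parcs G)}"

lemma pair_graph_path_graph: "pair_graph (path_graph k)"
proof
  show "finite (parcs (path_graph k))"
    by (rule finite_subset[of _ "{1..k} \<times> {1..k}"]) (auto simp: path_graph_def)
qed (auto simp: path_graph_def symmetric_def sym_def)

lemma pair_graph_strong_product:
  assumes "finite I" and "\<And>i. i \<in> I \<Longrightarrow> pair_graph (G i)"
  shows "pair_graph (strong_product I G)"
proof
  let ?V = "\<Pi>\<^sub>E i\<in>I. pverts (G i)"
  have fin: "finite ?V"
    using assms by (intro finite_PiE) (auto simp: pair_graph_def pair_digraph_def
        pair_fin_digraph.pair_finite_verts)
  then show "finite (pverts (strong_product I G))"
    by (simp add: strong_product_def)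
  show "finite (parcs (strong_product I G))"
    by (rule finite_subset[of _ "?V \<times> ?V"]) (use fin in \<open>auto simp: strong_product_def\<close>)
  have "(y, x) \<in> parcs (G i)" if "i \<in> I" "(x, y) \<in> parcs (G i)" for i x y
    using assms(2)[OF that(1)] that(2)
    by (auto simp: pair_graph_def pair_pseudo_graph_def pair_sym_digraph_def
        pair_sym_digraph_axioms_def
        symmetric_def sym_def)
  then show "symmetric (with_proj (strong_product I G))"
    by (fastforce simp: strong_product_def symmetric_def sym_def)
qed (auto simp: strong_product_def)

lemma card_strong_power_path_graph: "card (pverts (strong_power (path_graph k) n)) = k ^ n"
  by (simp add: strong_power_def strong_product_def path_graph_def card_PiE)

end

theory Submission
  imports Defs "HOL-Analysis.Convex"
begin

text \<open>
  Put \<open>e = 1/k\<close> and measure sets by their density. The claimed bound \<open>profile e n \<alpha>\<close> is the least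
  density of the neighborhood of a corner cube in \<open>t\<close> coordinates times a full box, of the
  complement of such a set, or of the whole grid; here real side lengths are allowed. The proof is
  by induction on \<open>n\<close>, cutting \<open>A\<close> into its \<open>k\<close> layers along the last coordinate.

  The layer of the neighborhood of \<open>A\<close> at a coordinate contains the neighborhoods of the layers of
  \<open>A\<close> at adjacent coordinates. Telescoping along the path between the thinnest and the thickest
  layer gives, for \<open>F\<close> the bound in dimension \<open>n\<close> and \<open>g\<close> the densities of the layers, a total of
  at least \<open>(\<Sum>l. F (g l)) - F (min g) + F (max g)\<close> times \<open>k ^ n\<close>
  (\<open>sum_dominating_neighbors\<close>).

  Since \<open>F\<close> is concave (\<open>concave_on_profile0\<close>), the worst densities with a given mean are of one of
  two kinds: some layers are empty and the others have equal density, or some layers are full and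
  the others have equal density (\<open>profile_Suc_le_layers\<close>, \<open>profile_Suc_le_two_level\<close>). These two
  kinds are exchanged by passing to the complement of the neighborhood, so essentially one
  inequality remains (\<open>profile_Suc_le_slab\<close>). If the density \<open>F c\<close> in the layers is attained by a
  cube, the resulting box is no better than a cube of one dimension more, by superadditivity of the
  geometric mean (\<open>grow_Suc_mult_le\<close>). If it is attained by the complement of a cube, then already
  a slab or a two-dimensional cube is at least as good (\<open>thickened_complement_dichotomy\<close>).
\<close>

section \<open>Thickening corner cubes\<close>

text \<open>
  In the orthant of dimension \<open>t\<close>, the \<open>e\<close>-thickening of a corner cube of volume \<open>x\<close> has volume
  \<open>grow e t x\<close>, and the part of the cube not covered by the \<open>e\<close>-thickening of its complement has
  volume \<open>shrink e t x\<close>. They are inverse to each other, except that \<open>shrink\<close> is truncated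
  at \<open>0\<close>; the results below use this to pass from a set to the complement of its neighborhood.
\<close>

definition grow :: "real \<Rightarrow> nat \<Rightarrow> real \<Rightarrow> real" where
  "grow e t x = (root t x + e) ^ t"

definition shrink :: "real \<Rightarrow> nat \<Rightarrow> real \<Rightarrow> real" where
  "shrink e t x = (max 0 (root t x - e)) ^ t"

lemma shrink_mono: "shrink e t x \<le> shrink e t y" if "x \<le> y" "t \<ge> 1"
  using that real_root_le_mono[of t x y] unfolding shrink_def
  by (intro power_mono max.mono) (auto simp: Suc_le_eq)

lemma shrink_nonneg: "0 \<le> shrink e t x"
  by (simp add: shrink_def)

lemma shrink_grow: "shrink e t (grow e t x) = x" if "0 \<le> e" "0 \<le> x" "t \<ge> 1"
  using that by (simp add: shrink_def grow_def real_root_power_cancel)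

lemma grow_shrink: "grow e t (shrink e t x) = x" if "0 \<le> e" "0 \<le> x" "t \<ge> 1" "e \<le> root t x"
  using that by (simp add: shrink_def grow_def real_root_power_cancel)

lemma le_grow_shrink: "x \<le> grow e t (shrink e t x)" if "0 \<le> e" "0 \<le> x" "t \<ge> 1"
proof (cases "e \<le> root t x")
  case True
  then show ?thesis using that by (simp add: grow_shrink)
next
  case False
  then have "root t x ^ t \<le> e ^ t" using that by (intro power_mono) auto
  then show ?thesis using False that by (simp add: shrink_def grow_def zero_power)
qed

lemma grow_le_imp_le_shrink: "x \<le> shrink e t y" if "grow e t x \<le> y" "0 \<le> e" "0 \<le> x" "t \<ge> 1"
  using shrink_mono[OF that(1,4), of e] shrink_grow[OF that(2-4)] by simp

section \<open>Superadditivity of the geometric mean\<close>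

text \<open>
  Weighted AM-GM with weights \<open>1/(t+1)\<close> and \<open>t/(t+1)\<close>. After division by \<open>Q ^ Suc t\<close> it is
  Bernoulli's inequality for the mean of \<open>P / Q\<close> and \<open>t\<close> copies of \<open>1\<close>.
\<close>

lemma weighted_am_gm_power:
  fixes P Q :: real
  assumes "P \<ge> 0" "Q \<ge> 0"
  shows "P * Q ^ t \<le> ((P + real t * Q) / real (Suc t)) ^ Suc t"
proof (cases "Q = 0")
  case True
  then show ?thesis using assms by (cases t) auto
next
  case False
  then have Q: "Q > 0" using assms by simp
  define x where "x = (P / Q - 1) / real (Suc t)"
  have "- 1 \<le> - 1 / real (Suc t)" by (simp add: field_simps)
  also have "\<dots> \<le> x" unfolding x_def using assms Q by (intro divide_right_mono) auto
  finally have "1 + real (Suc t) * x \<le> (1 + x) ^ Suc t"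
    by (rule Bernoulli_inequality)
  then have "P / Q \<le> (1 + x) ^ Suc t"
    by (simp add: x_def del: power_Suc of_nat_Suc)
  then have "P / Q * Q ^ Suc t \<le> (1 + x) ^ Suc t * Q ^ Suc t"
    using Q by (intro mult_right_mono) auto
  also have "\<dots> = ((1 + x) * Q) ^ Suc t" by (simp only: power_mult_distrib)
  also have "(1 + x) * Q = (P + real t * Q) / real (Suc t)"
  proof -
    have "real (Suc t) * x * Q = P - Q"
      using Q by (simp add: x_def left_diff_distrib del: of_nat_Suc)
    then have "(1 + x) * Q * real (Suc t) = P + real t * Q"
      by (simp add: algebra_simps)
    then show ?thesis by (simp add: eq_divide_eq del: of_nat_Suc)
  qed
  finally show ?thesis using Q by simp
qed

text \<open>
  Superadditivity of the geometric mean of \<open>t + 1\<close> numbers, applied to \<open>(a, b, \<dots>, b)\<close> and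
  \<open>(e, \<dots>, e)\<close>: divide by the geometric mean \<open>W\<close> of the sums and apply AM-GM to the two
  families of quotients, which add up to \<open>1\<close> in each coordinate.
\<close>

lemma root_add_le_mult:
  assumes "0 < e" "0 \<le> a" "0 \<le> b"
  shows "root (Suc t) (a * b ^ t) + e \<le> root (Suc t) ((a + e) * (b + e) ^ t)"
proof -
  define g where "g = root (Suc t) (a * b ^ t)"
  define W where "W = root (Suc t) ((a + e) * (b + e) ^ t)"
  have g: "g \<ge> 0" "g ^ Suc t = a * b ^ t" using assms by (simp_all add: g_def del: power_Suc)
  have W: "W > 0" "W ^ Suc t = (a + e) * (b + e) ^ t"
    using assms by (simp_all add: W_def add_pos_pos add_nonneg_pos del: power_Suc)
  have *: "z / W \<le> (x / (a + e) + real t * (y / (b + e))) / real (Suc t)"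
    if "x \<ge> 0" "y \<ge> 0" "z ^ Suc t = x * y ^ t" for x y z
  proof (rule power_le_imp_le_base)
    have "(z / W) ^ Suc t = (x / (a + e)) * (y / (b + e)) ^ t"
      unfolding power_divide W(2) that(3) by simp
    also have "\<dots> \<le> ((x / (a + e) + real t * (y / (b + e))) / real (Suc t)) ^ Suc t"
      using assms that by (intro weighted_am_gm_power) auto
    finally show "(z / W) ^ Suc t \<le> \<dots>" .
    show "0 \<le> (x / (a + e) + real t * (y / (b + e))) / real (Suc t)"
      using assms that by simp
  qed
  have "g / W + e / W \<le> (a / (a + e) + real t * (b / (b + e))) / real (Suc t)
      + (e / (a + e) + real t * (e / (b + e))) / real (Suc t)"
    using assms g by (intro add_mono *) auto
  also have "\<dots> = ((a / (a + e) + e / (a + e)) + real t * (b / (b + e) + e / (b + e))) / real (Suc t)"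
    by (simp add: field_simps del: of_nat_Suc)
  also have "\<dots> = 1" using assms by (simp flip: add_divide_distrib)
  finally have "g + e \<le> W" using W(1) by (simp add: field_simps)
  then show ?thesis by (simp add: g_def W_def)
qed

text \<open>
  A box \<open>[0,y] \<times> [0,s]\<^sup>t\<close> has at least the thickened volume of the \<open>(t+1)\<close>-dimensional cube with
  the same volume.
\<close>

lemma grow_Suc_mult_le:
  assumes "0 < e" "0 \<le> y" "0 \<le> c" "t \<ge> 1"
  shows "grow e (Suc t) (y * c) \<le> (y + e) * grow e t c"
proof -
  have "root (Suc t) (y * c) + e \<le> root (Suc t) ((y + e) * (root t c + e) ^ t)"
    using root_add_le_mult[of e y "root t c" t] assms by simp
  then have "grow e (Suc t) (y * c) \<le> root (Suc t) ((y + e) * (root t c + e) ^ t) ^ Suc t"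
    using assms unfolding grow_def by (intro power_mono) auto
  also have "\<dots> = (y + e) * grow e t c"
    using assms unfolding grow_def by (intro real_root_pow_pos2) auto
  finally show ?thesis .
qed

text \<open>
  The dual form for the uncovered part: by the Galois connection between \<open>grow\<close> and \<open>shrink\<close> it
  is the preceding inequality for the shrunken box.
\<close>

lemma shrink_mult_le_Suc:
  assumes "0 < e" "e \<le> y" "0 \<le> d" "t \<ge> 1"
  shows "(y - e) * shrink e t d \<le> shrink e (Suc t) (y * d)"
proof (cases "e \<le> root t d")
  case True
  show ?thesis
  proof (rule grow_le_imp_le_shrink)
    have "grow e (Suc t) ((y - e) * shrink e t d) \<le> (y - e + e) * grow e t (shrink e t d)"
      using assms by (intro grow_Suc_mult_le) (auto simp: shrink_nonneg)
    then show "grow e (Suc t) ((y - e) * shrink e t d) \<le> y * d"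
      using True assms by (simp add: grow_shrink)
  qed (use assms in \<open>auto simp: shrink_nonneg\<close>)
next
  case False
  then have "shrink e t d = 0" using assms by (simp add: shrink_def zero_power)
  then show ?thesis by (simp add: shrink_nonneg)
qed

section \<open>Slabs over complements of cubes\<close>

text \<open>
  The interaction of the two extremal shapes. The set in question is a slab of thickness \<open>y\<close> over
  the complement of a \<open>t\<close>-dimensional corner cube of side \<open>q\<close>; its volume is \<open>x = y * (1 - q ^ t)\<close>.
  Its thickened volume is at least that of a full slab of volume \<open>x\<close>, which is \<open>x + e\<close>, or at least
  that of a two-dimensional corner cube times a full box, which is \<open>(sqrt x + e)\<^sup>2\<close>.

  With \<open>S\<close> the difference quotient of \<open>t\<close>-th powers between \<open>p\<close> and \<open>q\<close>, the first alternative
  follows from \<open>p ^ t \<le> y * S\<close>, and the second one from nonnegativity of a quadratic polynomial in \<open>sqrt y\<close> with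
  leading coefficient \<open>S\<close>. For \<open>S \<ge> 1\<close> the polynomial is a square plus nonnegative terms. For
  \<open>S < 1\<close> it is decreasing on the range of \<open>sqrt y\<close> where \<open>y * S < p ^ t\<close>, so it
  suffices to look at the end point \<open>z0\<close> of that range.
\<close>

lemma thickened_complement_dichotomy:
  fixes p q y :: real
  assumes "0 \<le> p" "p \<le> q" "q \<le> 1" "0 \<le> y" "t \<ge> 1"
  defines "e \<equiv> q - p"
  shows "y * (1 - q ^ t) + e \<le> (y + e) * (1 - p ^ t)
       \<or> (sqrt (y * (1 - q ^ t)) + e)\<^sup>2 \<le> (y + e) * (1 - p ^ t)"
proof -
  define S where "S = (\<Sum>i<t. p ^ (t - Suc i) * q ^ i)"
  define c where "c = 1 - q ^ t"
  have e: "0 \<le> e" "e \<le> 1" using assms by (auto simp: e_def)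
  have qp: "q ^ t - p ^ t = e * S"
    unfolding S_def e_def by (rule power_diff_sumr2)
  have c0: "0 \<le> c" unfolding c_def using assms by (simp add: power_le_one)
  have S_ge: "real t * p ^ (t - 1) \<le> S"
  proof -
    have "p ^ (t - 1) \<le> p ^ (t - Suc i) * q ^ i" if "i < t" for i
    proof -
      have "p ^ (t - 1) = p ^ (t - Suc i) * p ^ i" using that by (simp flip: power_add)
      also have "\<dots> \<le> p ^ (t - Suc i) * q ^ i"
        using assms by (intro mult_left_mono power_mono) auto
      finally show ?thesis .
    qed
    then show ?thesis unfolding S_def
      using sum_bounded_below[of "{..<t}" "p ^ (t - 1)" "\<lambda>i. p ^ (t - Suc i) * q ^ i"] by simp
  qed
  have "0 \<le> real t * p ^ (t - 1)" using assms by simp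
  then have S0: "0 \<le> S" using S_ge by linarith
  define z where "z = sqrt y"
  define w where "w = sqrt c"
  have z: "z \<ge> 0" "z\<^sup>2 = y" and w: "w \<ge> 0" "w\<^sup>2 = c"
    using assms c0 by (auto simp: z_def w_def)
  have p_t: "p ^ t = 1 - c - e * S" using qp by (simp add: c_def)
  have linear: ?thesis if "p ^ t \<le> y * S"
  proof -
    have "0 \<le> e * (y * S - p ^ t)" using that e by simp
    also have "\<dots> = (y + e) * (1 - p ^ t) - (y * c + e)"
      unfolding p_t by (simp add: algebra_simps)
    finally show ?thesis by (simp add: c_def)
  qed
  have quadratic: ?thesis if "0 \<le> S * z\<^sup>2 - 2 * w * z + w\<^sup>2 - e * (1 - S)"
  proof -
    have "0 \<le> e * (S * z\<^sup>2 - 2 * w * z + w\<^sup>2 - e * (1 - S))" using that e by simp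
    also have "\<dots> = (z\<^sup>2 + e) * (w\<^sup>2 + e * S) - (z * w + e)\<^sup>2"
      by (simp add: algebra_simps power2_eq_square)
    also have "\<dots> = (y + e) * (1 - p ^ t) - (sqrt (y * c) + e)\<^sup>2"
      unfolding p_t by (simp add: z w real_sqrt_mult) (simp add: z_def w_def)
    finally show ?thesis by (simp add: c_def)
  qed
  consider "S \<ge> 1" | "p ^ t \<le> y * S" | "S < 1" "y * S < p ^ t" by linarith
  then show ?thesis
  proof cases
    case 1
    have "0 \<le> (z - w)\<^sup>2 + (S - 1) * (z\<^sup>2 + e)" using 1 e by simp
    also have "\<dots> = S * z\<^sup>2 - 2 * w * z + w\<^sup>2 - e * (1 - S)"
      by (simp add: algebra_simps power2_eq_square)
    finally show ?thesis by (rule quadratic)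
  next
    case 2
    then show ?thesis by (rule linear)
  next
    case 3
    have "0 \<le> y * S" using assms S0 by simp
    then have "p ^ t \<noteq> 0" using 3 by linarith
    then have p: "0 < p" using assms by (auto simp: zero_power less_le)
    then have "0 < real t * p ^ (t - 1)" using assms by simp
    then have S: "0 < S" using S_ge by linarith
    define z0 where "z0 = sqrt (p ^ t / S)"
    have z0: "z0 \<ge> 0" "S * z0\<^sup>2 = p ^ t" using S p by (auto simp: z0_def)
    have "z \<le> z0" unfolding z_def z0_def using 3 S by (simp add: field_simps)
    \<comment> \<open>This places \<open>z0\<close> to the left of the vertex \<open>w / S\<close> of the quadratic.\<close>
    have "p ^ t * S \<le> c"
    proof -
      have "t \<noteq> 1" using 3 by (auto simp: S_def)
      then have "t \<ge> 2" using assms by simp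
      have "p ^ t * S + q ^ t \<le> p ^ (t - 1) + q ^ (t - 1)"
      proof (rule add_mono)
        have "p ^ t * S \<le> p ^ t * 1" using 3 p by (intro mult_left_mono) auto
        also have "\<dots> \<le> p ^ (t - 1)" using assms by (simp add: power_decreasing)
        finally show "p ^ t * S \<le> p ^ (t - 1)" .
        show "q ^ t \<le> q ^ (t - 1)" using assms by (simp add: power_decreasing)
      qed
      also have "\<dots> = (\<Sum>i\<in>{0, t - 1}. p ^ (t - Suc i) * q ^ i)"
        using \<open>t \<ge> 2\<close> by simp
      also have "\<dots> \<le> S" unfolding S_def
        using assms \<open>t \<ge> 2\<close> by (intro sum_mono2) auto
      finally show ?thesis using 3 by (simp add: c_def)
    qed
    have "(S * z0)\<^sup>2 = (S * z0\<^sup>2) * S" by (simp add: power2_eq_square)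
    then have "(S * z0)\<^sup>2 = p ^ t * S" by (simp only: z0(2))
    with \<open>p ^ t * S \<le> c\<close> have "S * z0 \<le> w"
      using w by (auto intro!: power2_le_imp_le[of "S * z0" w])
    \<comment> \<open>The quadratic takes the value \<open>1 - e - 2 * w * z0\<close> at \<open>z0\<close>.\<close>
    have "(2 * w * z0)\<^sup>2 \<le> (1 - e)\<^sup>2"
    proof -
      have "c \<le> real t * (1 - q)"
        using Bernoulli_inequality[of "q - 1" t] assms by (simp add: c_def algebra_simps)
      then have "4 * p ^ t * c \<le> 4 * p ^ t * (real t * (1 - q))"
        using p by (intro mult_left_mono) auto
      also have "\<dots> = (4 * p * (1 - q)) * (real t * p ^ (t - 1))"
        using assms by (cases t) auto
      also have "\<dots> \<le> (1 - e)\<^sup>2 * S"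
      proof (rule mult_mono[OF _ S_ge])
        have "0 \<le> ((1 - q) - p)\<^sup>2" by simp
        then show "4 * p * (1 - q) \<le> (1 - e)\<^sup>2"
          by (simp add: e_def power2_eq_square algebra_simps)
      qed (use p in auto)
      finally have "4 * c * (p ^ t / S) \<le> (1 - e)\<^sup>2"
        using S by (simp add: field_simps)
      moreover have "z0\<^sup>2 = p ^ t / S" using z0 S by (simp add: field_simps)
      ultimately show ?thesis by (simp add: power_mult_distrib w)
    qed
    then have "2 * w * z0 \<le> 1 - e" using e by (simp add: power2_le_iff_abs_le)
    moreover have "1 - e = S * z0\<^sup>2 + w\<^sup>2 - e * (1 - S)"
      by (simp add: z0 w p_t algebra_simps)
    ultimately have "0 \<le> S * z0\<^sup>2 - 2 * w * z0 + w\<^sup>2 - e * (1 - S)" by simp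
    \<comment> \<open>The product is the drop of the quadratic from \<open>z\<close> to \<open>z0\<close>.\<close>
    moreover have "0 \<le> (z0 - z) * (2 * w - S * (z + z0))"
    proof (rule mult_nonneg_nonneg)
      have "S * z \<le> S * z0" using \<open>z \<le> z0\<close> S by simp
      then show "0 \<le> 2 * w - S * (z + z0)"
        using \<open>S * z0 \<le> w\<close> by (simp add: algebra_simps)
    qed (use \<open>z \<le> z0\<close> in simp)
    ultimately show ?thesis by (intro quadratic) (simp add: algebra_simps power2_eq_square)
  qed
qed

section \<open>Concavity of the volume functions\<close>

lemma convex_power_nonneg: "convex_on {0::real..} (\<lambda>x. x ^ n)"
proof (cases "even n")
  case True
  show ?thesis by (rule convex_on_subset[OF convex_power_even[OF True]]) auto
qed (rule convex_power_odd)

text \<open>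
  Every tangent of \<open>grow e t\<close> lies above it. With \<open>b = root t m\<close>, the number
  \<open>(root t v + e) / (b + e)\<close> is a convex combination of \<open>root t v / b\<close> and \<open>1\<close> whose weights do
  not depend on \<open>v\<close>, so convexity of the \<open>t\<close>-th power bounds \<open>grow e t v\<close> by an affine function
  of \<open>v\<close>, with equality at \<open>m\<close>.
\<close>

lemma concave_on_grow:
  assumes "0 \<le> e" "t \<ge> 1"
  shows "concave_on {0..} (grow e t)"
proof
  fix u x y :: real
  assume u: "0 < u" "u < 1" and xy: "x \<in> {0..}" "y \<in> {0..}" "x < y"
  define m where "m = (1 - u) * x + u * y"
  define b where "b = root t m"
  have "0 < m" using u xy by (auto simp: m_def intro!: add_nonneg_pos mult_pos_pos)
  then have b: "0 < b" "b ^ t = m" using assms by (auto simp: b_def)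
  define \<theta> where "\<theta> = b / (b + e)"
  have \<theta>: "0 \<le> \<theta>" "\<theta> \<le> 1" "1 - \<theta> = e / (b + e)" using b assms by (auto simp: \<theta>_def field_simps)
  define K where "K = (b + e) ^ t"
  have K: "0 \<le> K" using b assms by (simp add: K_def)
  have tangent: "grow e t v \<le> K * (\<theta> * (v / m) + (1 - \<theta>))" if "0 \<le> v" for v
  proof -
    define a where "a = root t v"
    have a: "0 \<le> a" "a ^ t = v" using that assms by (auto simp: a_def)
    have "(a + e) ^ t = K * ((a + e) / (b + e)) ^ t"
      using b assms by (simp add: K_def power_divide)
    also have "(a + e) / (b + e) = (1 - \<theta>) * 1 + \<theta> * (a / b)"
      unfolding \<theta>(3) using b by (simp add: \<theta>_def add_divide_distrib)
    also have "K * ((1 - \<theta>) * 1 + \<theta> * (a / b)) ^ t \<le> K * ((1 - \<theta>) * 1 ^ t + \<theta> * (a / b) ^ t)"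
      using convex_onD[OF convex_power_nonneg \<theta>(1,2), of 1 "a / b" t] a b K
      by (intro mult_left_mono) auto
    finally show ?thesis by (simp add: grow_def a_def[symmetric] power_divide a b add.commute)
  qed
  have "(1 - u) * grow e t x + u * grow e t y
      \<le> (1 - u) * (K * (\<theta> * (x / m) + (1 - \<theta>))) + u * (K * (\<theta> * (y / m) + (1 - \<theta>)))"
    using u xy by (intro add_mono mult_left_mono tangent) auto
  also have "\<dots> = K * (\<theta> * (((1 - u) * x + u * y) / m) + (1 - \<theta>))"
    by (simp add: add_divide_distrib) (simp add: algebra_simps)
  also have "\<dots> = K" using \<open>0 < m\<close> by (simp flip: m_def)
  also have "\<dots> = grow e t m" by (simp add: K_def grow_def b_def)
  finally show "(1 - u) * grow e t x + u * grow e t y \<le> grow e t ((1 - u) *\<^sub>R x + u *\<^sub>R y)"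
    by (simp add: m_def)
qed simp

text \<open>
  The inverse of an increasing concave function is convex; the inequality \<open>x \<le> grow (shrink x)\<close>
  takes care of the truncation at \<open>0\<close>.
\<close>

lemma convex_on_shrink:
  assumes "0 \<le> e" "t \<ge> 1"
  shows "convex_on {0..} (shrink e t)"
proof
  fix u x y :: real
  assume u: "0 < u" "u < 1" and xy: "x \<in> {0..}" "y \<in> {0..}"
  define w where "w = (1 - u) * shrink e t x + u * shrink e t y"
  have "(1 - u) * x + u * y
      \<le> (1 - u) * grow e t (shrink e t x) + u * grow e t (shrink e t y)"
    using u xy assms by (intro add_mono mult_left_mono le_grow_shrink) auto
  also have "\<dots> \<le> grow e t w"
    using concave_onD[OF concave_on_grow[OF assms], of u "shrink e t x" "shrink e t y"] u
    by (simp add: w_def shrink_nonneg)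
  finally have "shrink e t ((1 - u) * x + u * y) \<le> shrink e t (grow e t w)"
    using assms by (intro shrink_mono) auto
  also have "\<dots> = w"
    using u assms by (intro shrink_grow) (auto simp: w_def shrink_nonneg)
  finally show "shrink e t ((1 - u) *\<^sub>R x + u *\<^sub>R y) \<le> w" by simp
qed simp

section \<open>The isoperimetric profile\<close>

text \<open>
  The isoperimetric bound in relative volumes. The value \<open>1\<close> is inserted separately so that
  dimension \<open>0\<close>, where the base of the induction lies, is covered as well.
\<close>

definition profile :: "real \<Rightarrow> nat \<Rightarrow> real \<Rightarrow> real" where
  "profile e n a = Min (insert 1 (\<Union>t\<in>{1..n}. {grow e t a, 1 - shrink e t (1 - a)}))"

lemma profile_le:
  shows profile_le_1: "profile e n a \<le> 1"
    and profile_le_grow: "t \<in> {1..n} \<Longrightarrow> profile e n a \<le> grow e t a"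
    and profile_le_shrink: "t \<in> {1..n} \<Longrightarrow> profile e n a \<le> 1 - shrink e t (1 - a)"
  unfolding profile_def by (blast intro!: Min_le finite.insertI finite_UN_I finite_atLeastAtMost)+

lemma le_profile_iff:
  "v \<le> profile e n a \<longleftrightarrow>
     v \<le> 1 \<and> (\<forall>t\<in>{1..n}. v \<le> grow e t a \<and> v \<le> 1 - shrink e t (1 - a))"
  unfolding profile_def by (subst Min_ge_iff) auto

lemma profile_cases:
  obtains (one) "profile e n a = 1"
    | (grow) t where "t \<in> {1..n}" "profile e n a = grow e t a"
    | (shrink) t where "t \<in> {1..n}" "profile e n a = 1 - shrink e t (1 - a)"
proof -
  have "profile e n a \<in> insert 1 (\<Union>t\<in>{1..n}. {grow e t a, 1 - shrink e t (1 - a)})"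
    unfolding profile_def by (rule Min_in) auto
  then show thesis using that by auto
qed

lemma profile_Suc_le: "profile e (Suc n) a \<le> profile e n a"
  unfolding le_profile_iff by (auto intro: profile_le)

lemma grow_nonneg: "0 \<le> grow e t x" if "0 \<le> e" "0 \<le> x"
  using that by (cases "t = 0") (auto simp: grow_def)

lemma shrink_le_1: "shrink e t x \<le> 1" if "0 \<le> e" "x \<le> 1" "t \<ge> 1"
proof -
  have "root t x \<le> 1" using that by simp
  then have "max 0 (root t x - e) \<le> 1" using that(1) by linarith
  then show ?thesis unfolding shrink_def by (intro power_le_one) auto
qed

lemma profile_nonneg: "0 \<le> profile e n a" if "0 \<le> e" "0 \<le> a"
  unfolding le_profile_iff using that by (auto intro: grow_nonneg shrink_le_1)

lemma profile_1: "profile e n 1 = 1" if "0 \<le> e"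
proof -
  have "1 \<le> grow e t 1" if "t \<in> {1..n}" for t
    using that \<open>0 \<le> e\<close> by (auto simp: grow_def intro!: one_le_power)
  then have "1 \<le> profile e n 1"
    unfolding le_profile_iff using that by (auto simp: shrink_def zero_power)
  then show ?thesis using profile_le_1[of e n 1] by simp
qed

text \<open>
  A minimum of concave functions is concave.
\<close>

lemma concave_on_profile:
  assumes "0 \<le> e"
  shows "concave_on {0..1} (profile e n)"
proof
  fix u x y :: real
  assume u: "0 < u" "u < 1" and xy: "x \<in> {0..1}" "y \<in> {0..1}"
  let ?m = "(1 - u) * x + u * y"
  have 1: "(1 - u) * profile e n x + u * profile e n y \<le> (1 - u) * c x + u * c y"
    if "profile e n x \<le> c x" "profile e n y \<le> c y" for c :: "real \<Rightarrow> real"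
    using that u by (intro add_mono mult_left_mono) auto
  have "(1 - u) * profile e n x + u * profile e n y \<le> profile e n ?m"
    unfolding le_profile_iff
  proof (intro conjI ballI)
    show "(1 - u) * profile e n x + u * profile e n y \<le> 1"
      using 1[of "\<lambda>_. 1"] by (simp add: profile_le)
    fix t assume t: "t \<in> {1..n}"
    have "(1 - u) * profile e n x + u * profile e n y \<le> (1 - u) * grow e t x + u * grow e t y"
      using t by (intro 1 profile_le)
    also have "\<dots> \<le> grow e t ?m"
      using concave_onD[OF concave_on_grow[of e t], of u x y] assms t u xy by simp
    finally show "(1 - u) * profile e n x + u * profile e n y \<le> grow e t ?m" .
    have "(1 - u) * profile e n x + u * profile e n y
        \<le> (1 - u) * (1 - shrink e t (1 - x)) + u * (1 - shrink e t (1 - y))"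
      using 1[of "\<lambda>x. 1 - shrink e t (1 - x)"] t by (simp add: profile_le)
    also have "\<dots> = 1 - ((1 - u) * shrink e t (1 - x) + u * shrink e t (1 - y))"
      by (simp add: algebra_simps)
    also have "\<dots> \<le> 1 - shrink e t (1 - ?m)"
    proof -
      have "1 - ?m = (1 - u) * (1 - x) + u * (1 - y)" by (simp add: algebra_simps)
      then show ?thesis
        using convex_onD[OF convex_on_shrink[of e t], of u "1 - x" "1 - y"] assms t u xy by simp
    qed
    finally show "(1 - u) * profile e n x + u * profile e n y \<le> 1 - shrink e t (1 - ?m)" .
  qed
  then show "(1 - u) * profile e n x + u * profile e n y \<le> profile e n ((1 - u) *\<^sub>R x + u *\<^sub>R y)"
    by simp
qed simp

text \<open>
  The empty set has an empty neighborhood, but \<open>profile\<close> is positive at \<open>0\<close> in general. Lowering a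
  nonnegative concave function at an end point of its domain keeps it concave.
\<close>

definition profile0 :: "real \<Rightarrow> nat \<Rightarrow> real \<Rightarrow> real" where
  "profile0 e n a = (if a = 0 then 0 else profile e n a)"

lemma concave_on_profile0:
  assumes "0 \<le> e"
  shows "concave_on {0..1} (profile0 e n)"
proof
  fix u x y :: real
  assume u: "0 < u" "u < 1" and xy: "x \<in> {0..1}" "y \<in> {0..1}" "x < y"
  have pos: "0 < (1 - u) * x + u * y" using u xy by (auto intro!: add_nonneg_pos mult_pos_pos)
  have "profile0 e n x \<le> profile e n x" "profile0 e n y \<le> profile e n y"
    using assms xy by (auto simp: profile0_def profile_nonneg)
  then have "(1 - u) * profile0 e n x + u * profile0 e n y
      \<le> (1 - u) * profile e n x + u * profile e n y"
    using u by (intro add_mono mult_left_mono) auto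
  also have "\<dots> \<le> profile e n ((1 - u) *\<^sub>R x + u *\<^sub>R y)"
    using concave_onD[OF concave_on_profile[OF assms], of u x y n] u xy by simp
  also have "\<dots> = profile0 e n ((1 - u) *\<^sub>R x + u *\<^sub>R y)"
    using pos by (simp add: profile0_def)
  finally show "(1 - u) * profile0 e n x + u * profile0 e n y
      \<le> profile0 e n ((1 - u) *\<^sub>R x + u *\<^sub>R y)" .
qed simp

section \<open>Raising the dimension of the profile\<close>

lemma slab_of_shrink_ge_grow:
  assumes "0 \<le> e" "0 \<le> y" "t \<ge> 1" "0 \<le> d" "d \<le> 1" "e \<le> root t d"
  shows "\<exists>s\<in>{1,2}. grow e s (y * (1 - d)) \<le> (y + e) * (1 - shrink e t d)"
proof -
  let ?q = "root t d"
  have q: "?q ^ t = d" "?q \<le> 1" using assms by auto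
  have "shrink e t d = (?q - e) ^ t" using assms by (simp add: shrink_def)
  then show ?thesis
    using thickened_complement_dichotomy[of "?q - e" ?q y t] assms
    unfolding q(1) by (auto simp: grow_def sqrt_def numeral_2_eq_2)
qed

text \<open>
  First extremal family of layers: a fraction \<open>y\<close> of the layers have density \<open>c\<close> and the others are
  empty. A corner cube in the layers becomes a box, which is compared with a
  cube of one dimension more; the complement of a corner cube is handled by the dichotomy.
\<close>

lemma profile_Suc_le_slab:
  assumes "0 < e" "0 < y" "0 \<le> c" "c \<le> 1"
  shows "profile e (Suc n) (y * c) \<le> (y + e) * profile e n c"
proof (cases e n c rule: profile_cases)
  case one
  have "profile e (Suc n) (y * c) \<le> grow e 1 (y * c)" by (rule profile_le) simp
  also have "\<dots> \<le> y + e" using assms by (simp add: grow_def mult_left_le)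
  finally show ?thesis using one by simp
next
  case (grow t)
  then have "profile e (Suc n) (y * c) \<le> grow e (Suc t) (y * c)" by (intro profile_le) simp
  also have "\<dots> \<le> (y + e) * grow e t c" using assms grow by (intro grow_Suc_mult_le) auto
  finally show ?thesis using grow by simp
next
  case (shrink t)
  show ?thesis
  proof (cases "e \<le> root t (1 - c)")
    case True
    then obtain s where "s \<in> {1, 2}" "grow e s (y * c) \<le> (y + e) * (1 - shrink e t (1 - c))"
      using slab_of_shrink_ge_grow[of e y t "1 - c"] assms shrink by auto
    moreover have "profile e (Suc n) (y * c) \<le> grow e s (y * c)"
      using \<open>s \<in> _\<close> shrink by (intro profile_le) auto
    ultimately show ?thesis using shrink by simp
  next
    case False
    then have "profile e n c = 1" using shrink by (simp add: shrink_def zero_power)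
    have "profile e (Suc n) (y * c) \<le> grow e 1 (y * c)" by (rule profile_le) simp
    also have "\<dots> \<le> y + e" using assms by (simp add: grow_def mult_left_le)
    finally show ?thesis using \<open>profile e n c = 1\<close> by simp
  qed
qed

text \<open>
  Second extremal family of layers: a fraction \<open>y\<close> of the layers are full and the others have
  density \<open>c\<close>. Passing to the complement of the neighborhood exchanges this family with the first
  one and \<open>grow\<close> with \<open>shrink\<close>, so the two main cases change roles: for a corner cube of density
  \<open>c\<close> the dichotomy is applied to the uncovered part, a slab of thickness \<open>1 - y - e\<close> over the
  complement of the thickened cube.
\<close>

lemma profile_Suc_le_coslab:
  assumes "0 < e" "0 \<le> y" "y + e \<le> 1" "0 \<le> c" "c \<le> 1"
  shows "profile e (Suc n) (y + (1 - y) * c) \<le> y + e + (1 - y - e) * profile e n c"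
proof -
  define \<alpha> where "\<alpha> = y + (1 - y) * c"
  have co: "1 - \<alpha> = (1 - y) * (1 - c)" by (simp add: \<alpha>_def algebra_simps)
  have total: "profile e (Suc n) \<alpha> \<le> y + e + (1 - y - e) * profile e n c" if "profile e n c = 1"
    unfolding that using profile_le_1[of e "Suc n" \<alpha>] by simp
  show ?thesis unfolding \<alpha>_def[symmetric]
  proof (cases e n c rule: profile_cases)
    case one
    then show "profile e (Suc n) \<alpha> \<le> y + e + (1 - y - e) * profile e n c" by (rule total)
  next
    case (shrink t)
    have "profile e (Suc n) \<alpha> \<le> 1 - shrink e (Suc t) (1 - \<alpha>)"
      using shrink by (intro profile_le) simp
    also have "\<dots> \<le> 1 - (1 - y - e) * shrink e t (1 - c)"
      unfolding co using shrink_mult_le_Suc[of e "1 - y" "1 - c" t] assms shrink by simp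
    finally show "profile e (Suc n) \<alpha> \<le> y + e + (1 - y - e) * profile e n c"
      unfolding shrink(2) by (simp add: algebra_simps)
  next
    case (grow t)
    show "profile e (Suc n) \<alpha> \<le> y + e + (1 - y - e) * profile e n c"
    proof (cases "profile e n c = 1")
      case True
      then show ?thesis by (rule total)
    next
      case False
      let ?G = "grow e t c" and ?z = "1 - y - e"
      have G: "0 \<le> ?G" "?G < 1" using False grow profile_le_1[of e n c] assms
        by (auto simp: grow_nonneg)
      have "e \<le> root t ?G"
        using assms grow by (simp add: grow_def real_root_power_cancel)
      then obtain s where s: "s \<in> {1, 2}"
        and "grow e s (?z * (1 - ?G)) \<le> (?z + e) * (1 - shrink e t ?G)"
        using slab_of_shrink_ge_grow[of e ?z t ?G] assms G grow by auto
      moreover have "shrink e t ?G = c" using assms grow by (simp add: shrink_grow)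
      ultimately have "?z * (1 - ?G) \<le> shrink e s (1 - \<alpha>)"
        unfolding co using assms G s by (intro grow_le_imp_le_shrink) auto
      moreover have "profile e (Suc n) \<alpha> \<le> 1 - shrink e s (1 - \<alpha>)"
        using s grow by (intro profile_le) auto
      ultimately show ?thesis using grow by (simp add: algebra_simps)
    qed
  qed
qed

text \<open>
  Two densities \<open>m < M\<close> with weights \<open>1 - L\<close> and \<open>L\<close>, of fixed mean \<open>\<alpha>\<close>. The right-hand side is
  concave along the line of pairs \<open>(m, M)\<close> with this mean. That line runs from \<open>(\<alpha>, \<alpha>)\<close> to the
  boundary, which it reaches either at \<open>m = 0\<close> or at \<open>M = 1\<close> according to whether \<open>\<alpha> \<le> L\<close>; these
  end points are the two extremal families. At \<open>(\<alpha>, \<alpha>)\<close> the inequality says that the profile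
  decreases with the dimension.
\<close>

lemma profile_Suc_le_two_level:
  assumes e: "0 < e" and L: "0 < L" "L + e \<le> 1" "0 \<le> m" "m < M" "M \<le> 1"
  defines "\<alpha> \<equiv> (1 - L) * m + L * M"
  shows "profile e (Suc n) \<alpha> \<le> (1 - L - e) * profile0 e n m + (L + e) * profile0 e n M"
proof -
  let ?F = "profile0 e n"
  have \<alpha>: "0 < \<alpha>" "m < \<alpha>" "\<alpha> < M"
  proof -
    have "\<alpha> - m = L * (M - m)" by (simp add: \<alpha>_def algebra_simps)
    moreover have "0 < L * (M - m)" using assms by simp
    ultimately show "m < \<alpha>" by linarith
    then show "0 < \<alpha>" using L by linarith
    have "M - \<alpha> = (1 - L) * (M - m)" by (simp add: \<alpha>_def algebra_simps)
    moreover have "0 < (1 - L) * (M - m)" using assms by simp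
    ultimately show "\<alpha> < M" by linarith
  qed
  have flat: "profile e (Suc n) \<alpha> \<le> ?F \<alpha>"
    using \<alpha> by (simp add: profile0_def profile_Suc_le)
  have segment: ?thesis
    if \<theta>: "0 \<le> \<theta>" "\<theta> \<le> 1" and m: "m = (1 - \<theta>) * \<alpha> + \<theta> * m0" "0 \<le> m0" "m0 \<le> 1"
      and M: "M = (1 - \<theta>) * \<alpha> + \<theta> * M0" "0 \<le> M0" "M0 \<le> 1"
      and endpoint: "profile e (Suc n) \<alpha> \<le> (1 - L - e) * ?F m0 + (L + e) * ?F M0" for \<theta> m0 M0
  proof -
    have concave: "(1 - \<theta>) * ?F \<alpha> + \<theta> * ?F v \<le> ?F ((1 - \<theta>) * \<alpha> + \<theta> * v)"
      if "0 \<le> v" "v \<le> 1" for v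
      using concave_onD[OF concave_on_profile0[of e n], of \<theta> \<alpha> v] e \<theta> \<alpha> that assms by simp
    have "profile e (Suc n) \<alpha> = (1 - \<theta>) * profile e (Suc n) \<alpha> + \<theta> * profile e (Suc n) \<alpha>"
      by (simp add: algebra_simps)
    also have "\<dots> \<le> (1 - \<theta>) * ?F \<alpha> + \<theta> * ((1 - L - e) * ?F m0 + (L + e) * ?F M0)"
      using \<theta> flat endpoint by (intro add_mono mult_left_mono) auto
    also have "\<dots> = (1 - L - e) * ((1 - \<theta>) * ?F \<alpha> + \<theta> * ?F m0)
        + (L + e) * ((1 - \<theta>) * ?F \<alpha> + \<theta> * ?F M0)"
      by (simp add: algebra_simps)
    also have "\<dots> \<le> (1 - L - e) * ?F m + (L + e) * ?F M"
      using concave[OF m(2,3)] concave[OF M(2,3)] e L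
      unfolding m(1)[symmetric] M(1)[symmetric] by (intro add_mono mult_left_mono) auto
    finally show ?thesis .
  qed
  show ?thesis
  proof (cases "\<alpha> \<le> L")
    case True
    show ?thesis
    proof (rule segment[of "(\<alpha> - m) / \<alpha>" 0 "\<alpha> / L"])
      have "(1 - (\<alpha> - m) / \<alpha>) * \<alpha> + (\<alpha> - m) / \<alpha> * (\<alpha> / L) = m + (\<alpha> - m) / L"
        using \<alpha> L by (simp add: field_simps)
      also have "\<dots> = M" using L by (simp add: \<alpha>_def field_simps)
      finally show "M = (1 - (\<alpha> - m) / \<alpha>) * \<alpha> + (\<alpha> - m) / \<alpha> * (\<alpha> / L)" ..
      have "profile e (Suc n) (L * (\<alpha> / L)) \<le> (L + e) * profile e n (\<alpha> / L)"
        using True \<alpha> assms by (intro profile_Suc_le_slab) auto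
      then show "profile e (Suc n) \<alpha> \<le> (1 - L - e) * ?F 0 + (L + e) * ?F (\<alpha> / L)"
        using L \<alpha> by (simp add: profile0_def)
    qed (use True \<alpha> L in \<open>auto simp: field_simps\<close>)
  next
    case False
    define m0 where "m0 = (\<alpha> - L) / (1 - L)"
    have L1: "L < 1" "\<alpha> < 1" using assms \<alpha> by auto
    have m0: "0 < m0" "m0 \<le> 1" "L + (1 - L) * m0 = \<alpha>"
      using False L1 by (auto simp: m0_def field_simps)
    define \<theta> where "\<theta> = (M - \<alpha>) / (1 - \<alpha>)"
    have \<theta>: "\<theta> * (1 - \<alpha>) = M - \<alpha>" using L1 by (simp add: \<theta>_def)
    show ?thesis
    proof (rule segment[of \<theta> m0 1])
      have co: "1 - \<alpha> = (1 - L) * (1 - m0)" "\<alpha> - m0 = L * (1 - m0)"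
        using m0(3) by (simp_all add: algebra_simps)
      have "(1 - L) * (\<alpha> - m) = (M - \<alpha>) * L" by (simp add: \<alpha>_def algebra_simps)
      then have "(1 - \<alpha>) * (\<alpha> - m) = (M - \<alpha>) * (\<alpha> - m0)"
        unfolding co by (metis mult.assoc mult.commute)
      also have "\<dots> = (1 - \<alpha>) * (\<theta> * (\<alpha> - m0))" by (simp flip: \<theta>)
      finally have "\<alpha> - m = \<theta> * (\<alpha> - m0)" using L1 by simp
      then show "m = (1 - \<theta>) * \<alpha> + \<theta> * m0" by (simp add: algebra_simps)
      show "M = (1 - \<theta>) * \<alpha> + \<theta> * 1" using \<theta> by (simp add: algebra_simps)
      have "profile e (Suc n) (L + (1 - L) * m0) \<le> L + e + (1 - L - e) * profile e n m0"
        using e L m0 by (intro profile_Suc_le_coslab) auto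
      then show "profile e (Suc n) \<alpha> \<le> (1 - L - e) * ?F m0 + (L + e) * ?F 1"
        using m0 e by (simp add: profile0_def profile_1 algebra_simps)
      show "0 \<le> \<theta>" "\<theta> \<le> 1" using \<alpha> L L1 by (auto simp: \<theta>_def field_simps)
    qed (use m0 in auto)
  qed
qed

text \<open>
  For layers of arbitrary densities \<open>g l\<close>, replace the concave function \<open>profile0\<close> by its chord
  between the smallest and the largest density. For these two fixed, the sum then depends on the
  mean only, which is the case of two densities. The weight \<open>L\<close> lies in \<open>[1/k, 1 - 1/k]\<close> because the smallest and the
  largest density are attained.
\<close>

lemma profile_Suc_le_layers:
  fixes g :: "'i \<Rightarrow> real"
  assumes I: "finite I" "i \<in> I" "j \<in> I"
    and g: "\<And>l. l \<in> I \<Longrightarrow> g i \<le> g l" "\<And>l. l \<in> I \<Longrightarrow> g l \<le> g j" "0 \<le> g i" "0 < g j" "g j \<le> 1"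
  defines "k \<equiv> real (card I)"
  shows "k * profile (1 / k) (Suc n) ((\<Sum>l\<in>I. g l) / k)
    \<le> (\<Sum>l\<in>I. profile0 (1 / k) n (g l)) - profile0 (1 / k) n (g i) + profile0 (1 / k) n (g j)"
proof -
  define e where "e = 1 / k"
  let ?F = "profile0 e n"
  define m M where "m = g i" and "M = g j"
  have k: "0 < k" using I by (auto simp: k_def card_gt_0_iff)
  then have e: "0 < e" "k * e = 1" by (auto simp: e_def)
  show ?thesis unfolding e_def[symmetric] m_def[symmetric] M_def[symmetric]
  proof (cases "m < M")
    case False
    then have all: "g l = M" if "l \<in> I" for l
      using g that unfolding m_def M_def by (meson le_less_trans not_less order_antisym)
    then have "m = M" using I by (simp add: m_def)
    have "(\<Sum>l\<in>I. g l) / k = M" "(\<Sum>l\<in>I. ?F (g l)) = k * ?F M" using k by (simp_all add: all k_def)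
    then show "k * profile e (Suc n) ((\<Sum>l\<in>I. g l) / k) \<le> (\<Sum>l\<in>I. ?F (g l)) - ?F m + ?F M"
      using \<open>m = M\<close> g(4) k by (simp add: profile0_def M_def profile_Suc_le)
  next
    case True
    define w where "w l = (g l - m) / (M - m)" for l
    have w: "0 \<le> w l" "w l \<le> 1" "g l = (1 - w l) * m + w l * M" if "l \<in> I" for l
    proof -
      show "0 \<le> w l" "w l \<le> 1" using g(1,2)[OF that] True by (auto simp: w_def m_def M_def)
      have "w l * (M - m) = g l - m" using True by (simp add: w_def)
      then show "g l = (1 - w l) * m + w l * M" by (simp add: algebra_simps)
    qed
    have wi: "w i = 0" "w j = 1" using True by (auto simp: w_def m_def M_def)
    define L where "L = (\<Sum>l\<in>I. w l) / k"
    have "i \<noteq> j" using True by (auto simp: m_def M_def)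
    have "1 \<le> (\<Sum>l\<in>I. w l)" using member_le_sum[of j I w] I w wi by auto
    moreover have "(\<Sum>l\<in>I. w l) \<le> k - 1"
    proof -
      have "(\<Sum>l\<in>I. w l) = (\<Sum>l\<in>I - {i}. w l)" using I wi by (simp add: sum.remove)
      also have "\<dots> \<le> (\<Sum>l\<in>I - {i}. 1)" using w by (intro sum_mono) auto
      also have "\<dots> = k - 1" using I k by (simp add: k_def of_nat_diff Suc_le_eq)
      finally show ?thesis .
    qed
    ultimately have L: "0 < L" "L + e \<le> 1" using k by (auto simp: L_def e_def field_simps)
    have mean: "(\<Sum>l\<in>I. (1 - w l) * a + w l * b) = k * ((1 - L) * a + L * b)" for a b
      using k by (simp add: sum.distrib sum_subtractf L_def k_def algebra_simps
          flip: sum_distrib_left sum_distrib_right)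
    have "(\<Sum>l\<in>I. g l) / k = (1 - L) * m + L * M"
      using w mean[of m M] k by simp
    moreover have "profile e (Suc n) ((1 - L) * m + L * M)
        \<le> (1 - L - e) * ?F m + (L + e) * ?F M"
      using e L True g by (intro profile_Suc_le_two_level) (auto simp: m_def M_def)
    ultimately have "k * profile e (Suc n) ((\<Sum>l\<in>I. g l) / k)
        \<le> k * ((1 - L - e) * ?F m + (L + e) * ?F M)"
      using k by simp
    also have "\<dots> = k * ((1 - L) * ?F m + L * ?F M) + k * e * (?F M - ?F m)"
      by (simp add: algebra_simps)
    also have "\<dots> = (\<Sum>l\<in>I. (1 - w l) * ?F m + w l * ?F M) - ?F m + ?F M"
      unfolding mean e(2) by simp
    also have "\<dots> \<le> (\<Sum>l\<in>I. ?F (g l)) - ?F m + ?F M"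
    proof -
      have "(1 - w l) * ?F m + w l * ?F M \<le> ?F (g l)" if "l \<in> I" for l
        using concave_onD[OF concave_on_profile0[of e n] w(1,2)[OF that], of m M] e True g
        unfolding w(3)[OF that] by (simp add: m_def M_def)
      then show ?thesis by (simp add: sum_mono)
    qed
    finally show "k * profile e (Suc n) ((\<Sum>l\<in>I. g l) / k) \<le> (\<Sum>l\<in>I. ?F (g l)) - ?F m + ?F M" .
  qed
qed

section \<open>Layers of strong powers\<close>

lemma pverts_strong_power: "pverts (strong_power G n) = (\<Pi>\<^sub>E i\<in>{1..n}. pverts G)"
  by (simp add: strong_power_def strong_product_def)

lemma finite_pverts_strong_power: "finite (pverts (strong_power G n))" if "finite (pverts G)"
  using that by (simp add: pverts_strong_power finite_PiE)

lemma closed_neighborhood_subset: "closed_neighborhood G A \<subseteq> pverts G"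
  by (auto simp: closed_neighborhood_def)

lemma mem_closed_neighborhood_strong_power_iff:
  assumes "A \<subseteq> pverts (strong_power G n)"
  shows "v \<in> closed_neighborhood (strong_power G n) A \<longleftrightarrow>
    v \<in> pverts (strong_power G n) \<and>
    (\<exists>u\<in>A. \<forall>i\<in>{1..n}. u i = v i \<or> (u i, v i) \<in> parcs G)"
  using assms
  by (auto simp: closed_neighborhood_def strong_power_def strong_product_def subset_iff)

definition slice :: "'a pair_pre_digraph \<Rightarrow> nat \<Rightarrow> (nat \<Rightarrow> 'a) set \<Rightarrow> 'a \<Rightarrow> (nat \<Rightarrow> 'a) set" where
  "slice G n A x = {v \<in> pverts (strong_power G n). v(Suc n := x) \<in> A}"

lemma slice_subset: "slice G n A x \<subseteq> pverts (strong_power G n)"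
  by (auto simp: slice_def)

lemma fun_upd_mem_pverts_strong_power:
  assumes "v \<in> pverts (strong_power G n)" "x \<in> pverts G"
  shows "v(Suc n := x) \<in> pverts (strong_power G (Suc n))"
  using assms
  by (auto simp: pverts_strong_power PiE_iff extensional_def)

lemma bij_betw_slices:
  assumes "A \<subseteq> pverts (strong_power G (Suc n))"
  shows "bij_betw (\<lambda>(x, v). v(Suc n := x)) (SIGMA x:pverts G. slice G n A x) A"
proof (rule bij_betwI[where g = "\<lambda>u. (u (Suc n), u(Suc n := undefined))"])
  show "(\<lambda>u. (u (Suc n), u(Suc n := undefined))) \<in> A \<rightarrow> (SIGMA x:pverts G. slice G n A x)"
    using assms by (auto simp: slice_def pverts_strong_power PiE_iff extensional_def subset_iff)
qed (auto simp: slice_def pverts_strong_power PiE_iff extensional_def fun_upd_idem_iff)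

lemma card_eq_sum_slices:
  assumes "A \<subseteq> pverts (strong_power G (Suc n))" "finite (pverts G)"
  shows "card A = (\<Sum>x\<in>pverts G. card (slice G n A x))"
  using bij_betw_same_card[OF bij_betw_slices[OF assms(1)]] assms(2)
    finite_subset[OF slice_subset finite_pverts_strong_power[OF assms(2)]]
  by (simp add: card_SigmaI)

lemma closed_neighborhood_slice_subset:
  assumes A: "A \<subseteq> pverts (strong_power G (Suc n))" and y: "y \<in> pverts G"
    and xy: "x = y \<or> (x, y) \<in> parcs G"
  shows "closed_neighborhood (strong_power G n) (slice G n A x)
    \<subseteq> slice G n (closed_neighborhood (strong_power G (Suc n)) A) y"
proof
  fix v assume "v \<in> closed_neighborhood (strong_power G n) (slice G n A x)"
  then obtain u where v: "v \<in> pverts (strong_power G n)" and u: "u(Suc n := x) \<in> A"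
    and near: "\<forall>i\<in>{1..n}. u i = v i \<or> (u i, v i) \<in> parcs G"
    unfolding mem_closed_neighborhood_strong_power_iff[OF slice_subset]
    by (auto simp: slice_def)
  have "\<forall>i\<in>{1..Suc n}. (u(Suc n := x)) i = (v(Suc n := y)) i
      \<or> ((u(Suc n := x)) i, (v(Suc n := y)) i) \<in> parcs G"
    using near xy by auto
  then have "v(Suc n := y) \<in> closed_neighborhood (strong_power G (Suc n)) A"
    unfolding mem_closed_neighborhood_strong_power_iff[OF A]
    using u v y by (blast intro: fun_upd_mem_pverts_strong_power)
  then show "v \<in> slice G n (closed_neighborhood (strong_power G (Suc n)) A) y"
    using v by (simp add: slice_def)
qed

section \<open>Isoperimetry in strong powers of paths\<close>

text \<open>
  If \<open>b\<close> dominates \<open>a\<close> at every point and its neighbors, then walking from \<open>m\<close> to \<open>M\<close> the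
  differences \<open>b i - a i\<close> are at least the increments of \<open>a\<close>, which telescope to \<open>a M - a m\<close>.
\<close>

lemma sum_dominating_neighbors:
  fixes a b :: "nat \<Rightarrow> real"
  assumes "m \<in> {1..k}" "M \<in> {1..k}"
    and dom: "\<And>i j. i \<in> {1..k} \<Longrightarrow> j \<in> {1..k} \<Longrightarrow> i \<le> Suc j \<Longrightarrow> j \<le> Suc i \<Longrightarrow> a j \<le> b i"
  shows "(\<Sum>i=1..k. a i) - a m + a M \<le> (\<Sum>i=1..k. b i)"
proof -
  have "a M - a m \<le> (\<Sum>i=1..k. b i - a i)"
  proof (cases "m \<le> M")
    case True
    have "a M - a m = (\<Sum>i=m..<M. a (Suc i) - a i)"
      using True by (simp add: sum_Suc_diff')
    also have "\<dots> \<le> (\<Sum>i=m..<M. b i - a i)"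
      using assms by (intro sum_mono) auto
    also have "\<dots> \<le> (\<Sum>i=1..k. b i - a i)"
      using assms by (intro sum_mono2) auto
    finally show ?thesis .
  next
    case False
    have "a M - a m = (\<Sum>i=M..<m. - a (Suc i) - - a i)"
      using False by (subst sum_Suc_diff') auto
    also have "\<dots> \<le> (\<Sum>i=M..<m. b (Suc i) - a (Suc i))"
      using assms by (intro sum_mono) auto
    also have "\<dots> = (\<Sum>i=Suc M..<Suc m. b i - a i)"
      by (simp only: sum.shift_bounds_Suc_ivl)
    also have "\<dots> \<le> (\<Sum>i=1..k. b i - a i)"
      using assms by (intro sum_mono2) auto
    finally show ?thesis .
  qed
  then show ?thesis by (simp add: sum_subtractf)
qed

text \<open>
  Induction on the dimension. The neighborhood of each layer of \<open>A\<close> lies in the layers of the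
  neighborhood of \<open>A\<close> at the same and at adjacent coordinates, so the latter sum up to at least the
  former, with the neighborhood of the thinnest layer \<open>i\<close> replaced by that of the thickest layer \<open>j\<close>.
\<close>

lemma profile_le_card_closed_neighborhood:
  assumes k: "k \<ge> 1"
    and "A \<subseteq> pverts (strong_power (path_graph k) n)" "A \<noteq> {}"
  shows "real k ^ n * profile (1 / real k) n (real (card A) / real k ^ n)
    \<le> real (card (closed_neighborhood (strong_power (path_graph k) n) A))"
  using assms(2,3)
proof (induction n arbitrary: A)
  let ?G = "path_graph k"
  have verts: "pverts ?G = {1..k}" "finite (pverts ?G)" by (simp_all add: path_graph_def)
  note fin = finite_pverts_strong_power[OF verts(2)]
  {
    case 0
    have "A \<subseteq> closed_neighborhood (strong_power ?G 0) A"
      using 0 by (auto simp: closed_neighborhood_def)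
    then have "closed_neighborhood (strong_power ?G 0) A \<noteq> {}" using 0 by auto
    then have "1 \<le> card (closed_neighborhood (strong_power ?G 0) A)"
      using finite_subset[OF closed_neighborhood_subset fin] by (simp add: Suc_le_eq card_gt_0_iff)
    then show ?case
      using profile_le_1[of "1 / real k" 0 "real (card A)"] by simp
  next
    case (Suc n)
    let ?K = "real k ^ n" and ?e = "1 / real k"
    let ?N = "closed_neighborhood (strong_power ?G n)"
    let ?NA = "closed_neighborhood (strong_power ?G (Suc n)) A"
    let ?F = "profile0 ?e n"
    have K: "?K > 0" using k by simp
    define s where "s x = slice ?G n A x" for x
    define g where "g x = real (card (s x)) / ?K" for x
    define a where "a x = real (card (?N (s x)))" for x
    define b where "b x = real (card (slice ?G n ?NA x))" for x
    have fin_s: "finite (s x)" for x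
      unfolding s_def using finite_subset[OF slice_subset fin] .
    have F_le: "?K * ?F (g x) \<le> a x" for x
    proof (cases "s x = {}")
      case True
      then show ?thesis by (simp add: g_def a_def profile0_def)
    next
      case False
      have "?K * ?F (g x) = ?K * profile ?e n (g x)"
        using False fin_s K by (simp add: profile0_def g_def)
      also have "\<dots> \<le> a x"
        unfolding g_def a_def using False by (intro Suc.IH) (auto simp: s_def slice_subset)
      finally show ?thesis .
    qed
    have sum_g: "(\<Sum>x=1..k. g x) / real k = real (card A) / real k ^ Suc n"
    proof -
      have "(\<Sum>x=1..k. g x) = real (card A) / ?K"
        using card_eq_sum_slices[OF Suc.prems(1) verts(2)]
        by (simp add: g_def s_def verts(1) flip: sum_divide_distrib)
      then show ?thesis by simp
    qed
    have ne: "{1..k} \<noteq> {}" using k by simp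
    obtain i where i: "i \<in> {1..k}" "\<And>l. l \<in> {1..k} \<Longrightarrow> g i \<le> g l"
      using ex_is_arg_min_if_finite[OF finite_atLeastAtMost ne, of g]
      by (auto simp: is_arg_min_linorder)
    obtain j where j: "j \<in> {1..k}" "\<And>l. l \<in> {1..k} \<Longrightarrow> g l \<le> g j"
      using ex_is_arg_min_if_finite[OF finite_atLeastAtMost ne, of "\<lambda>l. - g l"]
      by (auto simp: is_arg_min_linorder)
    have "0 \<le> g i" by (simp add: g_def)
    have "0 < g j"
    proof (rule ccontr)
      assume "\<not> 0 < g j"
      then have "g l = 0" if "l \<in> {1..k}" for l
      proof -
        have "0 \<le> g l" by (simp add: g_def)
        then show ?thesis using j(2)[OF that] \<open>\<not> 0 < g j\<close> by linarith
      qed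
      then have "card A = 0" using sum_g k by simp
      then show False using Suc.prems finite_subset[OF Suc.prems(1) fin] by simp
    qed
    have "g j \<le> 1"
    proof -
      have "card (s j) \<le> k ^ n"
        using card_mono[OF fin, of "s j" n] slice_subset[of ?G n A j]
        by (simp add: s_def card_strong_power_path_graph)
      then have "real (card (s j)) \<le> ?K" by (metis of_nat_le_iff of_nat_power)
      then show ?thesis using K by (simp add: g_def)
    qed
    have "real k ^ Suc n * profile ?e (Suc n) (real (card A) / real k ^ Suc n)
        = ?K * (real (card {1..k}) * profile (1 / real (card {1..k})) (Suc n)
            ((\<Sum>x=1..k. g x) / real (card {1..k})))"
      unfolding sum_g[symmetric] by simp
    also have "\<dots> \<le> ?K * ((\<Sum>x=1..k. ?F (g x)) - ?F (g i) + ?F (g j))"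
      using profile_Suc_le_layers[of "{1..k}" i j g n] i j \<open>0 \<le> g i\<close> \<open>0 < g j\<close> \<open>g j \<le> 1\<close> K
      by (intro mult_left_mono) auto
    also have "\<dots> = (\<Sum>x\<in>{1..k} - {i}. ?K * ?F (g x)) + ?K * ?F (g j)"
      using i by (simp add: sum.remove algebra_simps sum_distrib_left)
    also have "\<dots> \<le> (\<Sum>x\<in>{1..k} - {i}. a x) + a j"
      by (intro add_mono sum_mono F_le)
    also have "\<dots> = (\<Sum>x=1..k. a x) - a i + a j"
      using i by (simp add: sum.remove)
    also have "\<dots> \<le> (\<Sum>x=1..k. b x)"
    proof (rule sum_dominating_neighbors[OF i(1) j(1)])
      fix x y assume xy: "x \<in> {1..k}" "y \<in> {1..k}" "x \<le> Suc y" "y \<le> Suc x"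
      then have "y = x \<or> (y, x) \<in> parcs ?G" by (auto simp: path_graph_def)
      then have "?N (s y) \<subseteq> slice ?G n ?NA x"
        unfolding s_def using Suc.prems xy verts
        by (intro closed_neighborhood_slice_subset) auto
      then show "a y \<le> b x"
        unfolding a_def b_def
        using card_mono[OF finite_subset[OF slice_subset fin]] by simp
    qed
    also have "\<dots> = real (card ?NA)"
      using card_eq_sum_slices[OF closed_neighborhood_subset verts(2), of n A] verts
      by (simp add: b_def)
    finally show ?case .
  }
qed

theorem corollary1p4:
  fixes k n :: nat and \<alpha> :: real and A :: "(nat \<Rightarrow> nat) set"
  assumes "k \<ge> 1" and "n \<ge> 1"
    and "A \<subseteq> pverts (strong_power (path_graph k) n)"
    and "A \<noteq> {}"
    and "real (card A) = \<alpha> * real k ^ n"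
  shows "real (card (closed_neighborhood (strong_power (path_graph k) n) A)) \<ge>
    real k ^ n *
      Min (\<Union>t\<in>{1..n}.
        {1,
         (\<alpha> powr (1 / real t) + 1 / real k) ^ t,
         1 - (max 0 ((1 - \<alpha>) powr (1 / real t) - 1 / real k)) ^ t})"
proof -
  have K: "real k ^ n > 0" using assms by simp
  have \<alpha>: "\<alpha> = real (card A) / real k ^ n" using assms K by (simp add: field_simps)
  have "card A \<le> k ^ n"
    using card_mono[OF finite_pverts_strong_power assms(3)]
    by (simp add: card_strong_power_path_graph) (simp add: path_graph_def)
  then have "real (card A) \<le> real k ^ n" by (metis of_nat_le_iff of_nat_power)
  then have "0 \<le> \<alpha>" "\<alpha> \<le> 1" using K by (auto simp: \<alpha>)
  then have "(\<Union>t\<in>{1..n}.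
        {1,
         (\<alpha> powr (1 / real t) + 1 / real k) ^ t,
         1 - (max 0 ((1 - \<alpha>) powr (1 / real t) - 1 / real k)) ^ t})
      = (\<Union>t\<in>{1..n}. {1, grow (1 / real k) t \<alpha>, 1 - shrink (1 / real k) t (1 - \<alpha>)})"
    by (intro SUP_cong) (auto simp: grow_def shrink_def root_powr_inverse)
  also have "\<dots> = insert 1 (\<Union>t\<in>{1..n}. {grow (1 / real k) t \<alpha>, 1 - shrink (1 / real k) t (1 - \<alpha>)})"
    using assms(2) by auto
  finally show ?thesis
    using profile_le_card_closed_neighborhood[OF assms(1,3,4)]
    by (simp only: profile_def \<alpha>)
qed

end
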